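(* Let $G$ be a connected graph with minimum degree at least $2$ and maximum degree $\Delta$, and let $G'$ be obtained from $G$ by subdividing each edge of $G$ with at most $m$ vertices. Then \[ a(G')\geq \frac{\min\left\{\frac{1}{\Delta}a(G),4\right\}}{2 (m+1)^2}. \]
   Context: $a(H)$ denotes the algebraic connectivity of a graph $H$, i.e. the second smallest eigenvalue of its Laplacian matrix. Subdividing an edge $e$ with $j\ge 0$ vertices means replacing $e$ by an induced path with $j$ new internal vertices. *)

theory Defs
  imports
    "Graph_Theory.Graph_Theory"
    "Jordan_Normal_Form.Char_Poly"
begin

text \<open>
  A finite simple graph is a \<^locale>\<open>pair_graph\<close>: an undirected edge is a pair of opposite arcs, so
  the degree of a vertex is its \<^const>\<open>out_degree\<close>.
\<close>

definition min_degree :: "'a pair_pre_digraph \<Rightarrow> nat" where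
  "min_degree G = Min (out_degree (with_proj G) ` pverts G)"

definition max_degree :: "'a pair_pre_digraph \<Rightarrow> nat" where
  "max_degree G = Max (out_degree (with_proj G) ` pverts G)"

definition laplacian_mat :: "'a pair_pre_digraph \<Rightarrow> 'a list \<Rightarrow> real mat" where
  "laplacian_mat G vs = mat (length vs) (length vs) (\<lambda>(i, j).
     if i = j then real (out_degree (with_proj G) (vs ! i))
     else if (vs ! i, vs ! j) \<in> parcs G then - 1
     else 0)"

text \<open>
  The eigenvalues in increasing order, each repeated according to its multiplicity as a root of the
  characteristic polynomial. Different enumerations of the vertices give permutation-similar
  Laplacian matrices, so the choice of enumeration is irrelevant.
\<close>

definition laplacian_eigenvalues :: "'a pair_pre_digraph \<Rightarrow> real list" where
  "laplacian_eigenvalues G = sorted_list_of_multiset (proots (char_poly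
     (laplacian_mat G (SOME vs. distinct vs \<and> set vs = pverts G))))"

text \<open>Lists are indexed from 0, so index 1 is the second smallest eigenvalue.\<close>

definition algebraic_connectivity :: "'a pair_pre_digraph \<Rightarrow> real" where
  "algebraic_connectivity G = laplacian_eigenvalues G ! 1"

text \<open>
  \<open>H\<close> arises from \<open>G\<close> by subdividing each edge with at most \<open>m\<close> vertices. \<open>P (u, v)\<close> lists the new
  internal vertices of the path replacing the edge \<open>uv\<close>, in the order from \<open>u\<close> to \<open>v\<close>; the number
  of them may depend on the edge and may be 0, in which case the edge is kept.
\<close>

definition edge_subdivision ::
    "nat \<Rightarrow> 'a pair_pre_digraph \<Rightarrow> 'a pair_pre_digraph \<Rightarrow> bool" where
  "edge_subdivision m G H \<longleftrightarrow> (\<exists>P :: 'a \<times> 'a \<Rightarrow> 'a list.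
     (\<forall>(u, v) \<in> parcs G.
        length (P (u, v)) \<le> m \<and>
        distinct (P (u, v)) \<and>
        set (P (u, v)) \<inter> pverts G = {} \<and>
        P (v, u) = rev (P (u, v))) \<and>
     (\<forall>(u, v) \<in> parcs G. \<forall>(x, y) \<in> parcs G.
        {u, v} \<noteq> {x, y} \<longrightarrow> set (P (u, v)) \<inter> set (P (x, y)) = {}) \<and>
     pverts H = pverts G \<union> (\<Union>a \<in> parcs G. set (P a)) \<and>
     parcs H = (\<Union>(u, v) \<in> parcs G. set (zip (u # P (u, v)) (P (u, v) @ [v]))))"

end

theory Submission
  imports
    Defs
    "Jordan_Normal_Form.Schur_Decomposition"
begin

text \<open>
  Let \<open>E\<close> denote the Laplacian quadratic form. By the spectral theorem the algebraic connectivity is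
  the largest \<open>r\<close> with \<open>r \<Sum> x\<^sup>2 \<le> E x\<close> for all \<open>x\<close> of sum zero, so a Poincare inequality on the
  subdivided graph is needed, for functions \<open>x\<close> normalised to have sum zero over the old vertices.
  On the path of \<open>n\<close> edges that replaces an edge, write \<open>x\<close> as linear interpolation plus a remainder
  \<open>z\<close> that vanishes at both ends. The energy of the path is at least the energy \<open>D\<^sup>2 / n\<close> of the linear
  part, \<open>D\<close> being the difference of the end values, and by the Cauchy-Schwarz inequality on both
  sides of an inner vertex, \<open>z\<^sup>2\<close> there is at most \<open>n / 4\<close> times the excess. The values of the
  linear part are controlled by the values at the old vertices, hence by \<open>\<Sum> D\<^sup>2 / a(G)\<close>, where each
  old vertex is charged once for each of its at most \<open>\<Delta>\<close> edges.
\<close>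

section \<open>The second eigenvalue of a real symmetric matrix\<close>

lemma scalar_prod_self_pos:
  fixes v :: "real vec"
  assumes "v \<in> carrier_vec n" "v \<noteq> 0\<^sub>v n"
  shows "v \<bullet> v > 0"
proof -
  have "v \<bullet>c v > 0" using conjugate_square_greater_0_vec[OF assms(1)] assms(2) by auto
  moreover have "conjugate v = v" by (intro eq_vecI) auto
  ultimately show ?thesis by simp
qed

text \<open>Gram-Schmidt, applied to a basis that starts with \<open>v\<close>, leaves its first
  vector unchanged, so after normalisation the first column is still a multiple of \<open>v\<close>.
  Real vectors are their own conjugates, which turns \<open>corthogonal\<close> into ordinary
  orthogonality.\<close>

lemma orthonormal_basis_completion:
  fixes v :: "real vec"
  assumes v: "v \<in> carrier_vec n" and v0: "v \<noteq> 0\<^sub>v n" and n: "n \<noteq> 0"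
  shows "\<exists>U \<in> carrier_mat n n. transpose_mat U * U = 1\<^sub>m n \<and> (\<exists>c. col U 0 = c \<cdot>\<^sub>v v)"
proof -
  interpret cof_vec_space n "TYPE(real)" .
  define b where "b = basis_completion v"
  define ws where "ws = gram_schmidt n b"
  note bc = basis_completion[OF v v0, folded b_def]
  from bc have len_b: "length b = n" and hdb: "hd b = v" by auto
  from hdb len_b n obtain vs where bv: "b = v # vs" by (cases b) auto
  have ws: "set ws \<subseteq> carrier_vec n" "corthogonal ws" "length ws = n"
    using gram_schmidt_result[of b ws] bc unfolding ws_def by auto
  have "hd ws = v" using gram_schmidt_hd[OF v, of vs] unfolding ws_def bv .
  then have ws0: "ws ! 0 = v" using ws(3) n hd_conv_nth[of ws] by fastforce
  have wsc: "ws ! i \<in> carrier_vec n" if "i < n" for i using ws that by auto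
  have conj: "conjugate w = w" for w :: "real vec" by (intro eq_vecI) auto
  have orth: "ws ! i \<bullet> ws ! j = 0 \<longleftrightarrow> i \<noteq> j" if "i < n" "j < n" for i j
    using corthogonalD[OF ws(2), of i j] that ws(3) unfolding conj by simp
  have pos: "ws ! i \<bullet> ws ! i > 0" if "i < n" for i
    using orth[OF that that] scalar_prod_self_pos[OF wsc[OF that]] wsc[OF that]
    by (cases "ws ! i = 0\<^sub>v n") auto
  define s where "s i = 1 / sqrt (ws ! i \<bullet> ws ! i)" for i
  define U where "U = mat n n (\<lambda>(i, j). s j * (ws ! j) $ i)"
  have U: "U \<in> carrier_mat n n" unfolding U_def by simp
  have colU: "col U j = s j \<cdot>\<^sub>v ws ! j" if "j < n" for j
    using wsc[OF that] that by (intro eq_vecI) (auto simp: U_def)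
  have "transpose_mat U * U = 1\<^sub>m n"
  proof (rule eq_matI)
    fix i j assume "i < dim_row (1\<^sub>m n :: real mat)" "j < dim_col (1\<^sub>m n :: real mat)"
    then have ij: "i < n" "j < n" by auto
    have "(transpose_mat U * U) $$ (i, j) = col U i \<bullet> col U j"
      using ij U by simp
    also have "\<dots> = s i * s j * (ws ! i \<bullet> ws ! j)"
      using wsc[OF ij(1)] wsc[OF ij(2)] ij
      by (simp add: colU scalar_prod_smult_left scalar_prod_smult_right)
    also have "\<dots> = 1\<^sub>m n $$ (i, j)"
      using orth[OF ij] ij pos[OF ij(1)] by (auto simp: s_def)
    finally show "(transpose_mat U * U) $$ (i, j) = 1\<^sub>m n $$ (i, j)" .
  qed (use U in auto)
  moreover have "col U 0 = s 0 \<cdot>\<^sub>v v" using colU[of 0] n ws0 by simp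
  ultimately show ?thesis using U by blast
qed

text \<open>Induction on the list of roots: an eigenvector for the head is split off by an
  orthogonal change of basis, and the symmetric block that remains has the tail as its roots. Since
  the list is prescribed, the diagonal can later be taken in increasing order.\<close>

theorem real_symmetric_spectral:
  fixes A :: "real mat"
  assumes "A \<in> carrier_mat n n" and "transpose_mat A = A"
    and "char_poly A = (\<Prod>e \<leftarrow> es. [:- e, 1:])"
  shows "\<exists>P \<in> carrier_mat n n. transpose_mat P * P = 1\<^sub>m n \<and>
    A * P = P * mat_diag n (\<lambda>i. es ! i)"
  using assms
proof (induction es arbitrary: n A)
  case Nil
  then have "n = 0" using degree_monic_char_poly[of A n] by auto
  then show ?case using Nil by (intro bexI[of _ "1\<^sub>m 0"]) (auto intro!: eq_matI simp: mat_diag_def)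
next
  case (Cons e es)
  note A = Cons.prems(1) and sym = Cons.prems(2) and cp = Cons.prems(3)
  have "eigenvalue A e" unfolding eigenvalue_root_char_poly[OF A] cp by simp
  then obtain v where "eigenvector A v e" unfolding eigenvalue_def by blast
  then have v: "v \<in> carrier_vec n" "v \<noteq> 0\<^sub>v n" and Av: "A *\<^sub>v v = e \<cdot>\<^sub>v v"
    using A unfolding eigenvector_def by auto
  have n0: "n \<noteq> 0" using v by (metis carrier_vecD vec_of_dim_0)
  then obtain k where n: "n = Suc k" by (cases n) auto
  from orthonormal_basis_completion[OF v n0] obtain U c where
    U: "U \<in> carrier_mat n n" and UU: "transpose_mat U * U = 1\<^sub>m n" and U0: "col U 0 = c \<cdot>\<^sub>v v"
    by blast
  have UU': "U * transpose_mat U = 1\<^sub>m n"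
    using mat_mult_left_right_inverse[OF _ U UU] U by simp
  define C where "C = transpose_mat U * A * U"
  have C: "C \<in> carrier_mat n n" using U A unfolding C_def by auto
  have C_sym: "transpose_mat C = C"
    unfolding C_def using U A sym
    by (simp add: transpose_mult[of _ n n _ n] assoc_mult_mat[of _ n n _ n _ n])
  \<comment> \<open>Column 0 of \<open>U\<close> is a multiple of the eigenvector, so
    \<open>A\<close> scales it by \<open>e\<close>; orthonormality of the columns then clears the
    rest of column 0 of \<open>C\<close>, and symmetry of \<open>C\<close> clears row 0.\<close>
  have C0: "C $$ (i, 0) = (if i = 0 then e else 0)" if i: "i < n" for i
  proof -
    have "C $$ (i, 0) = (transpose_mat U * (A * U)) $$ (i, 0)"
      unfolding C_def using U A by (simp add: assoc_mult_mat[of _ n n _ n _ n])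
    also have "\<dots> = col U i \<bullet> col (A * U) 0" using i U A n0 by simp
    also have "col (A * U) 0 = A *\<^sub>v col U 0" using U A n0 by auto
    also have "\<dots> = e \<cdot>\<^sub>v col U 0" unfolding U0
      using A v Av by (simp add: mult_mat_vec smult_smult_assoc mult.commute)
    also have "col U i \<bullet> (e \<cdot>\<^sub>v col U 0) = e * (col U i \<bullet> col U 0)" using U by simp
    also have "col U i \<bullet> col U 0 = (transpose_mat U * U) $$ (i, 0)" using U i n0 by simp
    finally show ?thesis unfolding UU using i n0 by auto
  qed
  have C0': "C $$ (0, i) = (if i = 0 then e else 0)" if i: "i < n" for i
    using C0[OF i] C_sym C i n0 by (metis carrier_matD index_transpose_mat(1) neq0_conv)
  define A' where "A' = mat k k (\<lambda>(i, j). C $$ (Suc i, Suc j))"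
  have A': "A' \<in> carrier_mat k k" unfolding A'_def by simp
  let ?E = "mat 1 1 (\<lambda>_. e) :: real mat"
  have Cblock: "C = four_block_mat ?E (0\<^sub>m 1 k) (0\<^sub>m k 1) A'"
    by (rule eq_matI) (use C C0 C0' in \<open>auto simp: n A'_def\<close>)
  have A'_sym: "transpose_mat A' = A'"
    by (rule eq_matI) (use C_sym C in \<open>auto simp: n A'_def\<close>,
      metis C C_sym carrier_matD index_transpose_mat(1) n Suc_less_eq)
  have "similar_mat_wit C A (transpose_mat U) U"
    by (rule similar_mat_witI[of _ _ n]) (use U A C UU UU' in \<open>auto simp: C_def\<close>)
  then have "char_poly C = char_poly A"
    using char_poly_similar unfolding similar_mat_def by blast
  moreover have "char_poly C = char_poly ?E * char_poly A'"
    unfolding Cblock by (rule char_poly_four_block_zeros_col) (use A' in auto)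
  moreover have "char_poly ?E = [:- e, 1:]"
    by (simp add: char_poly_defs det_def sign_def)
  \<comment> \<open>The block form factors the characteristic polynomial; cancelling the nonzero
    factor of the root \<open>e\<close> yields the hypothesis of the induction for
    \<open>A'\<close>.\<close>
  ultimately have "[:- e, 1:] * char_poly A' = [:- e, 1:] * (\<Prod>e \<leftarrow> es. [:- e, 1:])"
    using cp by simp
  then have "char_poly A' = (\<Prod>e \<leftarrow> es. [:- e, 1:])"
    by (metis mult_cancel_left pCons_eq_0_iff zero_neq_one)
  from Cons.IH[OF A' A'_sym this] obtain P' where
    P': "P' \<in> carrier_mat k k" "transpose_mat P' * P' = 1\<^sub>m k"
      "A' * P' = P' * mat_diag k (\<lambda>i. es ! i)" by blast
  define R where "R = four_block_mat (1\<^sub>m 1) (0\<^sub>m 1 k) (0\<^sub>m k 1) P'"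
  let ?D = "mat_diag n (\<lambda>i. (e # es) ! i)"
  have R: "R \<in> carrier_mat n n" using P' unfolding R_def n by auto
  have D: "?D = four_block_mat ?E (0\<^sub>m 1 k) (0\<^sub>m k 1) (mat_diag k (\<lambda>i. es ! i))"
    by (rule eq_matI) (auto simp: n mat_diag_def nth_Cons')
  have RT: "transpose_mat R = four_block_mat (1\<^sub>m 1) (0\<^sub>m 1 k) (0\<^sub>m k 1) (transpose_mat P')"
    unfolding R_def using P'(1) by (subst transpose_four_block_mat[of _ 1 1 _ k _ k]) auto
  have RR: "transpose_mat R * R = 1\<^sub>m n"
    unfolding RT unfolding R_def using P'
    by (subst mult_four_block_mat[of _ 1 1 _ k _ k _ _ 1 _ k]) (auto simp: n)
  have CR: "C * R = R * ?D"
  proof -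
    have "C * R = four_block_mat ?E (0\<^sub>m 1 k) (0\<^sub>m k 1) (A' * P')"
      unfolding Cblock R_def using P' A'
      by (subst mult_four_block_mat[of _ 1 1 _ k _ k _ _ 1 _ k]) auto
    moreover have "R * ?D = four_block_mat ?E (0\<^sub>m 1 k) (0\<^sub>m k 1) (P' * mat_diag k (\<lambda>i. es ! i))"
      unfolding D R_def using P'
      by (subst mult_four_block_mat[of _ 1 1 _ k _ k _ _ 1 _ k]) (auto simp: mat_diag_def)
    ultimately show ?thesis using P'(3) by simp
  qed
  define P where "P = U * R"
  have P: "P \<in> carrier_mat n n" using U R unfolding P_def by simp
  have "transpose_mat P * P = transpose_mat R * ((transpose_mat U * U) * R)"
    unfolding P_def using U R
    by (simp add: transpose_mult[of _ n n _ n] assoc_mult_mat[of _ n n _ n _ n])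
  then have "transpose_mat P * P = 1\<^sub>m n" using UU RR R by simp
  moreover have "A * P = (U * transpose_mat U) * A * (U * R)"
    unfolding P_def UU' using A U R by simp
  then have "A * P = U * (C * R)"
    unfolding C_def using A U R by (simp add: assoc_mult_mat[of _ n n _ n _ n])
  then have "A * P = P * ?D"
    unfolding CR P_def using U R by (simp add: assoc_mult_mat[of _ n n _ n _ n])
  ultimately show ?case using P by blast
qed

text \<open>The polynomial splits over the complex numbers, and its roots there are real because the
  matrix is Hermitian. The factorisation then descends to the reals, where it is checked coefficient
  by coefficient.\<close>

lemma real_symmetric_char_poly_splits:
  fixes A :: "real mat"
  assumes A: "A \<in> carrier_mat n n" and sym: "transpose_mat A = A"
  shows "\<exists>es. char_poly A = (\<Prod>e \<leftarrow> es. [:- e, 1:])"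
proof -
  let ?B = "map_mat complex_of_real A"
  have B: "?B \<in> carrier_mat n n" using A by simp
  from char_poly_factorized[OF B] obtain as where as: "char_poly ?B = (\<Prod>a \<leftarrow> as. [:- a, 1:])"
    by blast
  have real: "a = complex_of_real (Re a)" if "a \<in> set as" for a
  proof -
    have "poly (char_poly ?B) a = 0"
      unfolding as poly_prod_list prod_list_zero_iff using that by force
    then obtain v where v: "v \<in> carrier_vec n" "v \<noteq> 0\<^sub>v n" and Bv: "?B *\<^sub>v v = a \<cdot>\<^sub>v v"
      using B unfolding eigenvalue_root_char_poly[OF B, symmetric] eigenvalue_def eigenvector_def
      by auto
    have Bsym: "transpose_mat ?B = ?B" using sym by (metis map_mat_transpose)
    have Bconj: "conjugate (?B *\<^sub>v v) = ?B *\<^sub>v conjugate v"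
      using A v by (intro eq_vecI) (auto simp: scalar_prod_def)
    have cv: "conjugate v \<in> carrier_vec n" using v by simp
    \<comment> \<open>Moving \<open>?B\<close> from one side of the Hermitian product to the other
      replaces \<open>a\<close> by its conjugate.\<close>
    have "a * (v \<bullet>c v) = (?B *\<^sub>v v) \<bullet>c v" unfolding Bv using v by simp
    also have "\<dots> = v \<bullet> (?B *\<^sub>v conjugate v)"
      using transpose_vec_mult_scalar[OF B cv v(1)] Bsym by simp
    also have "\<dots> = v \<bullet>c (a \<cdot>\<^sub>v v)" using Bconj Bv by simp
    also have "\<dots> = cnj a * (v \<bullet>c v)" using v by (simp add: conjugate_smult_vec)
    finally have "a * (v \<bullet>c v) = cnj a * (v \<bullet>c v)" .
    moreover have "v \<bullet>c v \<noteq> 0" using conjugate_square_eq_0_vec[OF v(1)] v(2) by simp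
    ultimately have "a = cnj a" by simp
    then show ?thesis by (metis Reals_cnj_iff of_real_Re)
  qed
  have "map_poly complex_of_real (char_poly A) = char_poly ?B"
    by (rule of_real_hom.char_poly_hom[OF A, symmetric])
  also have "\<dots> = (\<Prod>a \<leftarrow> as. map_poly complex_of_real [:- Re a, 1:])"
    unfolding as using real by (intro arg_cong[where f = prod_list] map_cong) auto
  also have "\<dots> = map_poly complex_of_real (\<Prod>e \<leftarrow> map Re as. [:- e, 1:])"
  proof -
    interpret p: map_poly_comm_ring_hom complex_of_real ..
    show ?thesis
      by (induction as) (simp_all del: mult_pCons_left add: p.hom_mult)
  qed
  finally have eq: "map_poly complex_of_real (char_poly A) = \<dots>" .
  have "char_poly A = (\<Prod>e \<leftarrow> map Re as. [:- e, 1:])"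
  proof (rule poly_eqI)
    fix i
    show "coeff (char_poly A) i = coeff (\<Prod>e \<leftarrow> map Re as. [:- e, 1:]) i"
      using arg_cong[OF eq, of "\<lambda>p. coeff p i"] by (simp add: coeff_map_poly)
  qed
  then show ?thesis by blast
qed


lemma orthogonal_mat_scalar_prod:
  fixes P :: "'a :: comm_ring_1 mat"
  assumes P: "P \<in> carrier_mat n n" and PP: "transpose_mat P * P = 1\<^sub>m n"
    and c: "c \<in> carrier_vec n" and d: "d \<in> carrier_vec n"
  shows "(P *\<^sub>v c) \<bullet> (P *\<^sub>v d) = c \<bullet> d"
proof -
  have "(P *\<^sub>v c) \<bullet> (P *\<^sub>v d) = (transpose_mat P *\<^sub>v (P *\<^sub>v c)) \<bullet> d"
    using transpose_vec_mult_scalar[OF P d, of "P *\<^sub>v c"] P c by simp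
  also have "transpose_mat P *\<^sub>v (P *\<^sub>v c) = (transpose_mat P * P) *\<^sub>v c"
    using P c by (subst assoc_mult_mat_vec[of _ n n _ n]) auto
  finally show ?thesis using PP c by simp
qed

lemma proots_prod_linear_factors:
  "proots (\<Prod>e \<leftarrow> es. [:- e, 1:]) = mset (es :: 'a :: idom list)"
proof (induction es)
  case (Cons e es)
  have "proots ([:- e, 1:] * (\<Prod>e \<leftarrow> es. [:- e, 1:])) = {#e#} + mset es"
    by (subst proots_mult) (auto simp: prod_list_zero_iff Cons.IH simp del: mult_pCons_left)
  then show ?case by simp
qed simp

text \<open>The product of linear factors does not depend on their order, so the diagonalisation may
  be carried out along the sorted list. Diagonal entry \<open>i\<close> is then the eigenvalue that
  indexing into \<open>es\<close> returns.\<close>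

lemma real_symmetric_sorted_spectral:
  fixes A :: "real mat"
  assumes A: "A \<in> carrier_mat n n" and sym: "transpose_mat A = A"
  defines "es \<equiv> sorted_list_of_multiset (proots (char_poly A))"
  obtains P where "P \<in> carrier_mat n n" "transpose_mat P * P = 1\<^sub>m n"
    "A * P = P * mat_diag n (\<lambda>i. es ! i)" "length es = n" "sorted es"
proof -
  obtain fs where fs: "char_poly A = (\<Prod>e \<leftarrow> fs. [:- e, 1:])"
    using real_symmetric_char_poly_splits[OF A sym] by blast
  have es: "es = sort fs"
    unfolding es_def fs proots_prod_linear_factors by simp
  have "mset (map (\<lambda>e. [:- e, 1:]) es) = mset (map (\<lambda>e. [:- e, 1:]) fs)"
    unfolding es by simp
  then have cp: "char_poly A = (\<Prod>e \<leftarrow> es. [:- e, 1:])"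
    unfolding fs by (metis prod_mset_prod_list)
  have "length es = n"
    using degree_monic_char_poly[OF A] degree_linear_factors[of uminus es] unfolding cp by simp
  moreover have "sorted es" unfolding es by simp
  ultimately show thesis using that real_symmetric_spectral[OF A sym cp] by blast
qed

lemma mat_diag_mult_vec:
  fixes c :: "'a :: semiring_0 vec"
  assumes c: "c \<in> carrier_vec n"
  shows "mat_diag n f *\<^sub>v c = vec n (\<lambda>i. f i * c $ i)"
proof (rule eq_vecI)
  fix i assume "i < dim_vec (vec n (\<lambda>i. f i * c $ i))"
  then have i: "i < n" by simp
  have "(mat_diag n f *\<^sub>v c) $ i = (\<Sum>j = 0..<n. (if i = j then f j else 0) * c $ j)"
    using c i by (auto simp: mat_diag_def scalar_prod_def)
  also have "\<dots> = (\<Sum>j = 0..<n. if j = i then f j * c $ j else 0)"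
    by (intro sum.cong) auto
  finally show "(mat_diag n f *\<^sub>v c) $ i = vec n (\<lambda>i. f i * c $ i) $ i" using i by simp
qed (simp add: mat_diag_def)

section \<open>Variational bounds for the second eigenvalue, from both sides\<close>

lemma quadratic_form_eigencoordinates:
  fixes A :: "real mat"
  assumes A: "A \<in> carrier_mat n n" and P: "P \<in> carrier_mat n n"
    and PP: "transpose_mat P * P = 1\<^sub>m n" and AP: "A * P = P * mat_diag n f"
    and c: "c \<in> carrier_vec n"
  shows "(P *\<^sub>v c) \<bullet> (A *\<^sub>v (P *\<^sub>v c)) = (\<Sum>i<n. f i * (c $ i)\<^sup>2)"
proof -
  let ?D = "mat_diag n f"
  note Dc = mat_diag_mult_vec[OF c, of f]
  have "A *\<^sub>v (P *\<^sub>v c) = (A * P) *\<^sub>v c"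
    using A P c by (simp add: assoc_mult_mat_vec)
  also have "\<dots> = P *\<^sub>v (?D *\<^sub>v c)"
    unfolding AP using P c by (subst assoc_mult_mat_vec[of _ n n _ n]) auto
  finally have "(P *\<^sub>v c) \<bullet> (A *\<^sub>v (P *\<^sub>v c)) = c \<bullet> (?D *\<^sub>v c)"
    using orthogonal_mat_scalar_prod[OF P PP c, of "?D *\<^sub>v c"] Dc by simp
  also have "\<dots> = (\<Sum>i<n. f i * (c $ i)\<^sup>2)"
    unfolding Dc scalar_prod_def
    by (auto intro!: sum.cong simp: power2_eq_square atLeast0LessThan)
  finally show ?thesis .
qed

text \<open>The span of the first two eigenvectors has dimension two and therefore meets the
  hyperplane orthogonal to \<open>u\<close> in a nonzero vector. On this span the form is at most
  \<open>es ! 1\<close> times the squared norm.\<close>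

lemma second_eigenvalue_lower_bound:
  fixes A :: "real mat"
  assumes A: "A \<in> carrier_mat n n" and sym: "transpose_mat A = A" and n: "n \<ge> 2"
    and u: "u \<in> carrier_vec n"
    and bound: "\<And>y. y \<in> carrier_vec n \<Longrightarrow> y \<bullet> u = 0 \<Longrightarrow> \<mu> * (y \<bullet> y) \<le> y \<bullet> (A *\<^sub>v y)"
  shows "\<mu> \<le> sorted_list_of_multiset (proots (char_poly A)) ! 1"
proof -
  define es where "es = sorted_list_of_multiset (proots (char_poly A))"
  from real_symmetric_sorted_spectral[OF A sym, folded es_def] obtain P where
    P: "P \<in> carrier_mat n n" and PP: "transpose_mat P * P = 1\<^sub>m n"
    and AP: "A * P = P * mat_diag n (\<lambda>i. es ! i)" and len: "length es = n" and sorted: "sorted es"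
    by blast
  have "es ! 0 \<le> es ! 1" using sorted len n by (simp add: sorted_iff_nth_mono)
  define w where "w = transpose_mat P *\<^sub>v u"
  \<comment> \<open>coefficients of a vector orthogonal to \<open>u\<close> in the span of the first two eigenvectors\<close>
  obtain a b :: real where ab: "a * w $ 0 + b * w $ 1 = 0" and ab0: "a\<^sup>2 + b\<^sup>2 > 0"
  \<comment> \<open>If \<open>w $ 0\<close> vanishes, the first eigenvector itself is orthogonal to
    \<open>u\<close>; otherwise the pair \<open>(- w $ 1, w $ 0)\<close> solves the equation and is
    nonzero.\<close>
  proof (cases "w $ 0 = 0")
    case True
    then show thesis using that[of 1 0] by simp
  next
    case False
    then show thesis using that[of "- w $ 1" "w $ 0"] by (simp add: add_nonneg_pos)
  qed
  define c where "c = vec n (\<lambda>i. if i = 0 then a else if i = 1 then b else 0)"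
  have c: "c \<in> carrier_vec n" unfolding c_def by simp
  have two: "(\<Sum>i<n. if i = 0 then f i else if i = 1 then g i else 0) = f 0 + g 1"
    for f g :: "nat \<Rightarrow> real"
  proof -
    obtain k where "n = Suc (Suc k)" using n by (metis add_2_eq_Suc le_Suc_ex)
    then show ?thesis by (simp add: sum.lessThan_Suc_shift del: sum.lessThan_Suc)
  qed
  have "(P *\<^sub>v c) \<bullet> u = c \<bullet> w"
    using transpose_vec_mult_scalar[OF P c u] u P c unfolding w_def
    by (metis comm_scalar_prod mult_mat_vec_carrier transpose_carrier_mat)
  also have "\<dots> = (\<Sum>i<n. if i = 0 then a * w $ i else if i = 1 then b * w $ i else 0)"
    unfolding scalar_prod_def using P
    by (auto intro!: sum.cong simp: atLeast0LessThan c_def w_def)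
  also have "\<dots> = 0" unfolding two using ab by simp
  finally have "\<mu> * ((P *\<^sub>v c) \<bullet> (P *\<^sub>v c)) \<le> (P *\<^sub>v c) \<bullet> (A *\<^sub>v (P *\<^sub>v c))"
    using bound P c by simp
  moreover have "(P *\<^sub>v c) \<bullet> (P *\<^sub>v c) = a\<^sup>2 + b\<^sup>2"
  proof -
    have "c \<bullet> c = (\<Sum>i<n. if i = 0 then a\<^sup>2 else if i = 1 then b\<^sup>2 else 0)"
      unfolding scalar_prod_def
      by (auto intro!: sum.cong simp: atLeast0LessThan c_def power2_eq_square)
    then show ?thesis unfolding two orthogonal_mat_scalar_prod[OF P PP c c] .
  qed
  moreover have "(P *\<^sub>v c) \<bullet> (A *\<^sub>v (P *\<^sub>v c)) = es ! 0 * a\<^sup>2 + es ! 1 * b\<^sup>2"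
  proof -
    have "(\<Sum>i<n. es ! i * (c $ i)\<^sup>2) =
        (\<Sum>i<n. if i = 0 then es ! i * a\<^sup>2 else if i = 1 then es ! i * b\<^sup>2 else 0)"
      by (auto intro!: sum.cong simp: c_def)
    then show ?thesis unfolding two quadratic_form_eigencoordinates[OF A P PP AP c] .
  qed
  ultimately have "\<mu> * (a\<^sup>2 + b\<^sup>2) \<le> es ! 0 * a\<^sup>2 + es ! 1 * b\<^sup>2" by simp
  also have "\<dots> \<le> es ! 1 * (a\<^sup>2 + b\<^sup>2)"
    using mult_right_mono[OF \<open>es ! 0 \<le> es ! 1\<close>, of "a\<^sup>2"] by (simp add: algebra_simps)
  finally show ?thesis using ab0 unfolding es_def by simp
qed

text \<open>If \<open>es ! 1\<close> is at most 0, semidefiniteness suffices. Otherwise all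
  eigenvalues from index 1 on are positive, so the kernel vector \<open>u\<close> is a multiple of
  the first eigenvector, and a \<open>y\<close> orthogonal to it has coordinates only along
  eigenvalues that are at least \<open>es ! 1\<close>.\<close>

lemma second_eigenvalue_Rayleigh:
  fixes A :: "real mat"
  assumes A: "A \<in> carrier_mat n n" and sym: "transpose_mat A = A" and n: "n \<ge> 2"
    and psd: "\<And>y. y \<in> carrier_vec n \<Longrightarrow> 0 \<le> y \<bullet> (A *\<^sub>v y)"
    and u: "u \<in> carrier_vec n" "u \<noteq> 0\<^sub>v n" and Au: "A *\<^sub>v u = 0\<^sub>v n"
    and y: "y \<in> carrier_vec n" and yu: "y \<bullet> u = 0"
  shows "sorted_list_of_multiset (proots (char_poly A)) ! 1 * (y \<bullet> y) \<le> y \<bullet> (A *\<^sub>v y)"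
proof -
  define es where "es = sorted_list_of_multiset (proots (char_poly A))"
  from real_symmetric_sorted_spectral[OF A sym, folded es_def] obtain P where
    P: "P \<in> carrier_mat n n" and PP: "transpose_mat P * P = 1\<^sub>m n"
    and AP: "A * P = P * mat_diag n (\<lambda>i. es ! i)" and len: "length es = n" and sorted: "sorted es"
    by blast
  have PP': "P * transpose_mat P = 1\<^sub>m n"
    using mat_mult_left_right_inverse[OF _ P PP] P by simp
  have coord: "x = P *\<^sub>v (transpose_mat P *\<^sub>v x)" if "x \<in> carrier_vec n" for x
    using assoc_mult_mat_vec[of P n n "transpose_mat P" n x] P PP' that by simp
  have "y \<bullet> y \<ge> 0" using scalar_prod_self_pos[OF y] y by (cases "y = 0\<^sub>v n") auto
  show ?thesis unfolding es_def[symmetric]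
  proof (cases "es ! 1 \<le> 0")
    case True
    then have "es ! 1 * (y \<bullet> y) \<le> 0" using \<open>y \<bullet> y \<ge> 0\<close> by (simp add: mult_nonpos_nonneg)
    then show "es ! 1 * (y \<bullet> y) \<le> y \<bullet> (A *\<^sub>v y)" using psd[OF y] by linarith
  next
    case False
    have ge: "es ! 1 \<le> es ! i" if "i < n" "i \<noteq> 0" for i
      using sorted len that by (simp add: sorted_iff_nth_mono)
    define c where "c = transpose_mat P *\<^sub>v y"
    define w where "w = transpose_mat P *\<^sub>v u"
    have c: "c \<in> carrier_vec n" and w: "w \<in> carrier_vec n"
      using P y u unfolding c_def w_def by auto
    have Pc: "P *\<^sub>v c = y" and Pw: "P *\<^sub>v w = u" using coord y u unfolding c_def w_def by auto
    have Dw: "mat_diag n (\<lambda>i. es ! i) *\<^sub>v w \<in> carrier_vec n"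
      using mult_mat_vec_carrier[OF mat_diag_dim w] .
    \<comment> \<open>In eigencoordinates \<open>A *\<^sub>v u = 0\<^sub>v n\<close> reads
      \<open>es ! i * w $ i = 0\<close>, and the eigenvalue is positive for nonzero
      \<open>i\<close>.\<close>
    have w0: "w $ i = 0" if i: "i < n" "i \<noteq> 0" for i
    proof -
      have "0\<^sub>v n = transpose_mat P *\<^sub>v (A *\<^sub>v u)" using Au P by auto
      also have "A *\<^sub>v u = (A * P) *\<^sub>v w" using A P w Pw by (simp add: assoc_mult_mat_vec)
      also have "\<dots> = P *\<^sub>v (mat_diag n (\<lambda>i. es ! i) *\<^sub>v w)"
        unfolding AP using P w by (subst assoc_mult_mat_vec[of _ n n _ n]) auto
      also have "transpose_mat P *\<^sub>v \<dots> = (transpose_mat P * P) *\<^sub>v (mat_diag n (\<lambda>i. es ! i) *\<^sub>v w)"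
        using P Dw by (subst assoc_mult_mat_vec[of _ n n _ n]) auto
      also have "\<dots> = mat_diag n (\<lambda>i. es ! i) *\<^sub>v w" unfolding PP using Dw by simp
      finally have "(mat_diag n (\<lambda>i. es ! i) *\<^sub>v w) $ i = 0" using i by (metis index_zero_vec(1))
      then show ?thesis using ge[OF i] False i by (simp add: mat_diag_mult_vec[OF w])
    qed
    have n0: "0 < n" using n by simp
    have head: "(\<Sum>i<n. f i) = f 0 + (\<Sum>i\<in>{..<n} - {0}. f i)" for f :: "nat \<Rightarrow> real"
      using n0 by (simp add: sum.remove)
    have "w \<noteq> 0\<^sub>v n" using Pw u(2) P by auto
    then have "w $ 0 \<noteq> 0" using w0 w by (metis carrier_vecD eq_vecI index_zero_vec)
    moreover have "c \<bullet> w = 0" using orthogonal_mat_scalar_prod[OF P PP c w] Pc Pw yu by simp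
    moreover have "c \<bullet> w = (\<Sum>i<n. c $ i * w $ i)"
      using w by (simp add: scalar_prod_def atLeast0LessThan)
    ultimately have c0: "c $ 0 = 0" unfolding head using w0 by simp
    have "es ! 1 * (y \<bullet> y) = es ! 1 * (c \<bullet> c)"
      using orthogonal_mat_scalar_prod[OF P PP c c] Pc by simp
    also have "\<dots> = (\<Sum>i<n. es ! 1 * (c $ i)\<^sup>2)"
      using c by (simp add: scalar_prod_def atLeast0LessThan sum_distrib_left power2_eq_square)
    also have "\<dots> \<le> (\<Sum>i<n. es ! i * (c $ i)\<^sup>2)"
    proof (rule sum_mono)
      fix i assume "i \<in> {..<n}"
      then show "es ! 1 * (c $ i)\<^sup>2 \<le> es ! i * (c $ i)\<^sup>2"
        using ge[of i] c0 by (cases "i = 0") (auto intro: mult_right_mono)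
    qed
    also have "\<dots> = y \<bullet> (A *\<^sub>v y)"
      using quadratic_form_eigencoordinates[OF A P PP AP c] Pc by simp
    finally show "es ! 1 * (y \<bullet> y) \<le> y \<bullet> (A *\<^sub>v y)" .
  qed
qed

section \<open>Algebraic connectivity as a Rayleigh quotient\<close>

text \<open>Both arcs of an edge are counted, so this is twice the Laplacian quadratic form.\<close>

definition dirichlet_energy :: "'a pair_pre_digraph \<Rightarrow> ('a \<Rightarrow> real) \<Rightarrow> real" where
  "dirichlet_energy G x = (\<Sum>(u, v) \<in> parcs G. (x u - x v)\<^sup>2)"

context pair_graph
begin

lemma parcs_swap: "(u, v) \<in> parcs G \<Longrightarrow> (v, u) \<in> parcs G"
  using pair_sym_arcs unfolding symmetric_def sym_def by simp

lemma sum_parcs_swap: "(\<Sum>(u, v) \<in> parcs G. f u v) = (\<Sum>(u, v) \<in> parcs G. f v u)"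
  by (rule sum.reindex_bij_witness[of _ prod.swap prod.swap]) (auto intro: parcs_swap)

lemma sum_parcs_eq_sum_verts:
  "(\<Sum>(u, v) \<in> parcs G. f u v) = (\<Sum>u \<in> pverts G. \<Sum>v \<in> parcs G `` {u}. f u v)"
proof -
  have "parcs G `` {u} \<subseteq> pverts G" for u using in_arcsD2 by auto
  then have "finite (parcs G `` {u})" for u using pair_finite_verts finite_subset by blast
  then have "(\<Sum>u \<in> pverts G. \<Sum>v \<in> parcs G `` {u}. f u v)
      = (\<Sum>(u, v) \<in> Sigma (pverts G) (\<lambda>u. parcs G `` {u}). f u v)"
    using pair_finite_verts by (intro sum.Sigma) auto
  also have "Sigma (pverts G) (\<lambda>u. parcs G `` {u}) = parcs G"
    using in_arcsD1 by auto
  finally show ?thesis by simp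
qed

lemma out_degree_eq_card_Image: "out_degree (with_proj G) u = card (parcs G `` {u})"
proof -
  have "out_arcs (with_proj G) u = Pair u ` (parcs G `` {u})"
    unfolding out_arcs_def by auto
  then show ?thesis unfolding out_degree_def by (simp add: card_image inj_on_def)
qed

lemma sum_parcs_fst:
  "(\<Sum>(u, v) \<in> parcs G. g u) = (\<Sum>u \<in> pverts G. real (out_degree (with_proj G) u) * g u)"
  unfolding sum_parcs_eq_sum_verts out_degree_eq_card_Image by simp

context
  fixes vs :: "'a list"
  assumes vs: "distinct vs" "set vs = pverts G"
begin

lemma sum_nth_eq_sum_pverts: "(\<Sum>i<length vs. f (vs ! i)) = (\<Sum>v \<in> pverts G. f v)"
  by (rule sum.reindex_bij_betw[OF bij_betw_nth]) (use vs in auto)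

lemma laplacian_mat_mult_vec:
  assumes i: "i < length vs"
  shows "(laplacian_mat G vs *\<^sub>v vec (length vs) (\<lambda>i. x (vs ! i))) $ i =
    (\<Sum>v \<in> parcs G `` {vs ! i}. x (vs ! i) - x v)"
proof -
  let ?u = "vs ! i"
  \<comment> \<open>Row \<open>i\<close> as a function of the column's vertex, so that the sum over
    indices becomes a sum over vertices. Distinctness of \<open>vs\<close> matches the diagonal test
    on indices with equality of vertices.\<close>
  define l where "l v = (if ?u = v then real (out_degree (with_proj G) ?u)
    else if (?u, v) \<in> parcs G then - 1 else 0)" for v
  have N: "parcs G `` {?u} \<subseteq> pverts G" "?u \<notin> parcs G `` {?u}"
    using in_arcsD2 pair_no_loops by fastforce+
  have u: "?u \<in> pverts G" using nth_mem[OF i] vs(2) by simp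
  have "row (laplacian_mat G vs) i = vec (length vs) (\<lambda>j. l (vs ! j))"
    using i vs(1) unfolding laplacian_mat_def l_def
    by (intro eq_vecI) (simp_all add: nth_eq_iff_index_eq)
  moreover have "dim_row (laplacian_mat G vs) = length vs" unfolding laplacian_mat_def by simp
  ultimately have "(laplacian_mat G vs *\<^sub>v vec (length vs) (\<lambda>i. x (vs ! i))) $ i
      = (\<Sum>j<length vs. l (vs ! j) * x (vs ! j))"
    using i by (simp add: scalar_prod_def atLeast0LessThan)
  also have "\<dots> = (\<Sum>v \<in> pverts G. l v * x v)" by (rule sum_nth_eq_sum_pverts)
  also have "\<dots> = real (out_degree (with_proj G) ?u) * x ?u + (\<Sum>v \<in> pverts G - {?u}. l v * x v)"
    using pair_finite_verts u by (subst sum.remove[of _ ?u]) (auto simp: l_def)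
  also have "(\<Sum>v \<in> pverts G - {?u}. l v * x v) = (\<Sum>v \<in> parcs G `` {?u}. - x v)"
    using N pair_finite_verts by (intro sum.mono_neutral_cong_right) (auto simp: l_def)
  finally show ?thesis
    by (simp add: out_degree_eq_card_Image sum_subtractf sum_negf)
qed

lemma laplacian_mat_quadratic_form:
  fixes x :: "'a \<Rightarrow> real"
  defines "X \<equiv> vec (length vs) (\<lambda>i. x (vs ! i))"
  shows "X \<bullet> (laplacian_mat G vs *\<^sub>v X) = dirichlet_energy G x / 2"
proof -
  have "X \<bullet> (laplacian_mat G vs *\<^sub>v X)
      = (\<Sum>i<length vs. x (vs ! i) * (\<Sum>v \<in> parcs G `` {vs ! i}. x (vs ! i) - x v))"
    unfolding scalar_prod_def X_def using laplacian_mat_mult_vec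
    by (auto simp: laplacian_mat_def atLeast0LessThan intro!: sum.cong)
  also have "\<dots> = (\<Sum>u \<in> pverts G. x u * (\<Sum>v \<in> parcs G `` {u}. x u - x v))"
    by (rule sum_nth_eq_sum_pverts)
  also have "\<dots> = (\<Sum>(u, v) \<in> parcs G. x u * (x u - x v))"
    unfolding sum_parcs_eq_sum_verts by (simp add: sum_distrib_left)
  finally have *: "X \<bullet> (laplacian_mat G vs *\<^sub>v X) = (\<Sum>(u, v) \<in> parcs G. x u * (x u - x v))" .
  \<comment> \<open>Adding the contribution of the reversed arc completes the square:
    \<open>x u * (x u - x v) + x v * (x v - x u)\<close> is
    \<open>(x u - x v)\<^sup>2\<close>.\<close>
  also have "\<dots> = (\<Sum>(u, v) \<in> parcs G. x v * (x v - x u))" by (rule sum_parcs_swap)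
  finally have "2 * (X \<bullet> (laplacian_mat G vs *\<^sub>v X))
      = (\<Sum>(u, v) \<in> parcs G. x u * (x u - x v) + x v * (x v - x u))"
    using * by (simp add: sum.distrib case_prod_unfold)
  also have "\<dots> = dirichlet_energy G x"
    unfolding dirichlet_energy_def
    by (intro sum.cong) (auto simp: power2_eq_square algebra_simps)
  finally show ?thesis by simp
qed

lemma vec_eq_vertex_function:
  assumes "y \<in> carrier_vec (length vs)"
  obtains x where "y = vec (length vs) (\<lambda>i. x (vs ! i))"
proof -
  have "y = vec (length vs) (\<lambda>i. y $ inv_into {..<length vs} ((!) vs) (vs ! i))"
    using assms inj_on_nth[OF vs(1), of "{..<length vs}"] by (intro eq_vecI) auto
  then show thesis by (rule that[of "\<lambda>v. y $ inv_into {..<length vs} ((!) vs) v"])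
qed

end

text \<open>Extracts the very enumeration that \<open>SOME\<close> picks in the definition of the
  eigenvalues, so that the matrix bounds can be applied to its Laplacian.\<close>

lemma laplacian_enumeration:
  obtains vs where "distinct vs" "set vs = pverts G"
    "algebraic_connectivity G = sorted_list_of_multiset (proots (char_poly (laplacian_mat G vs))) ! 1"
    "laplacian_mat G vs \<in> carrier_mat (length vs) (length vs)"
    "transpose_mat (laplacian_mat G vs) = laplacian_mat G vs"
    "length vs = card (pverts G)"
proof -
  define vs where "vs = (SOME vs. distinct vs \<and> set vs = pverts G)"
  have "\<exists>vs. distinct vs \<and> set vs = pverts G"
    using finite_distinct_list[OF pair_finite_verts] by blast
  then have vs: "distinct vs \<and> set vs = pverts G" unfolding vs_def by (rule someI_ex)
  moreover have "transpose_mat (laplacian_mat G vs) = laplacian_mat G vs"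
    unfolding laplacian_mat_def by (rule eq_matI) (auto intro: parcs_swap)
  moreover have "length vs = card (pverts G)" using vs distinct_card by fastforce
  ultimately show thesis
    using that[of vs] vs_def
    unfolding algebraic_connectivity_def laplacian_eigenvalues_def
    by (simp add: laplacian_mat_def)
qed

lemma dirichlet_energy_nonneg: "dirichlet_energy G x \<ge> 0"
  unfolding dirichlet_energy_def by (intro sum_nonneg) auto

text \<open>The matrix bound with the all-ones vector for \<open>u\<close>: orthogonality to it is
  the condition of sum zero.\<close>

lemma algebraic_connectivity_lower_bound:
  assumes n: "card (pverts G) \<ge> 2"
    and bound: "\<And>x. (\<Sum>v \<in> pverts G. x v) = 0 \<Longrightarrow>
      r * (\<Sum>v \<in> pverts G. (x v)\<^sup>2) \<le> dirichlet_energy G x / 2"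
  shows "r \<le> algebraic_connectivity G"
proof -
  obtain vs where vs: "distinct vs" "set vs = pverts G" and
    L: "algebraic_connectivity G = sorted_list_of_multiset (proots (char_poly (laplacian_mat G vs))) ! 1"
    "laplacian_mat G vs \<in> carrier_mat (length vs) (length vs)"
    "transpose_mat (laplacian_mat G vs) = laplacian_mat G vs" "length vs = card (pverts G)"
    by (rule laplacian_enumeration)
  let ?u = "vec (length vs) (\<lambda>_. 1 :: real)"
  have "r * (y \<bullet> y) \<le> y \<bullet> (laplacian_mat G vs *\<^sub>v y)"
    if y: "y \<in> carrier_vec (length vs)" and yu: "y \<bullet> ?u = 0" for y
  proof -
    obtain x where x: "y = vec (length vs) (\<lambda>i. x (vs ! i))"
      using vec_eq_vertex_function[OF vs y] by blast
    have x0: "(\<Sum>v \<in> pverts G. x v) = 0"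
      using yu sum_nth_eq_sum_pverts[OF vs, of x] unfolding x
      by (simp add: scalar_prod_def atLeast0LessThan)
    have "y \<bullet> y = (\<Sum>v \<in> pverts G. (x v)\<^sup>2)"
      unfolding sum_nth_eq_sum_pverts[OF vs, symmetric] x
      by (simp add: scalar_prod_def atLeast0LessThan power2_eq_square)
    moreover have "y \<bullet> (laplacian_mat G vs *\<^sub>v y) = dirichlet_energy G x / 2"
      unfolding x by (rule laplacian_mat_quadratic_form[OF vs])
    ultimately show ?thesis using bound[OF x0] by simp
  qed
  then show ?thesis
    unfolding L(1) using second_eigenvalue_lower_bound[OF L(2,3), of ?u r] n L(4) by simp
qed

lemma algebraic_connectivity_nonneg:
  assumes "card (pverts G) \<ge> 2"
  shows "algebraic_connectivity G \<ge> 0"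
  using algebraic_connectivity_lower_bound[OF assms, of 0] dirichlet_energy_nonneg by simp

text \<open>The Laplacian is positive semidefinite and annihilates the all-ones vector, as it acts
  by differences along arcs; hence the Rayleigh bound applies with that vector for
  \<open>u\<close>.\<close>

lemma algebraic_connectivity_Rayleigh:
  assumes n: "card (pverts G) \<ge> 2" and x: "(\<Sum>v \<in> pverts G. x v) = 0"
  shows "algebraic_connectivity G * (\<Sum>v \<in> pverts G. (x v)\<^sup>2) \<le> dirichlet_energy G x / 2"
proof -
  obtain vs where vs: "distinct vs" "set vs = pverts G" and
    L: "algebraic_connectivity G = sorted_list_of_multiset (proots (char_poly (laplacian_mat G vs))) ! 1"
    "laplacian_mat G vs \<in> carrier_mat (length vs) (length vs)"
    "transpose_mat (laplacian_mat G vs) = laplacian_mat G vs" "length vs = card (pverts G)"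
    by (rule laplacian_enumeration)
  let ?u = "vec (length vs) (\<lambda>_. 1 :: real)"
  let ?y = "vec (length vs) (\<lambda>i. x (vs ! i))"
  have "?u $ 0 \<noteq> 0\<^sub>v (length vs) $ 0" using n L(4) by simp
  then have "?u \<noteq> 0\<^sub>v (length vs)" by metis
  moreover have "laplacian_mat G vs *\<^sub>v ?u = 0\<^sub>v (length vs)"
    using L(2) laplacian_mat_mult_vec[OF vs, of _ "\<lambda>_. 1"] by (intro eq_vecI) auto
  moreover have "0 \<le> y \<bullet> (laplacian_mat G vs *\<^sub>v y)" if "y \<in> carrier_vec (length vs)" for y
    using vec_eq_vertex_function[OF vs that] laplacian_mat_quadratic_form[OF vs]
      dirichlet_energy_nonneg by (metis zero_le_divide_iff zero_le_numeral)
  moreover have "?y \<bullet> ?u = 0"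
    using x sum_nth_eq_sum_pverts[OF vs, of x] by (simp add: scalar_prod_def atLeast0LessThan)
  ultimately have "algebraic_connectivity G * (?y \<bullet> ?y) \<le> ?y \<bullet> (laplacian_mat G vs *\<^sub>v ?y)"
    unfolding L(1) using second_eigenvalue_Rayleigh[OF L(2,3), of ?u ?y] n L(4) by simp
  moreover have "?y \<bullet> ?y = (\<Sum>v \<in> pverts G. (x v)\<^sup>2)"
    unfolding sum_nth_eq_sum_pverts[OF vs, symmetric]
    by (simp add: scalar_prod_def atLeast0LessThan power2_eq_square)
  ultimately show ?thesis using laplacian_mat_quadratic_form[OF vs, of x] by simp
qed

end

section \<open>Subdivided graphs\<close>

lemma path_energy_ge:
  fixes f :: "nat \<Rightarrow> real"
  assumes "a \<le> b"
  shows "(f b - f a)\<^sup>2 \<le> real (b - a) * (\<Sum>j = a..<b. (f j - f (Suc j))\<^sup>2)"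
proof (cases "a = b")
  case False
  define k D d where "k = real b - real a" and "D = f b - f a" and "d j = f (Suc j) - f j" for j
  have k: "k > 0" using assms False unfolding k_def by simp
  have D: "(\<Sum>j = a..<b. d j) = D" unfolding d_def D_def using assms by (simp add: sum_Suc_diff')
  \<comment> \<open>The increments telescope to \<open>D\<close>, so \<open>D / k\<close> is their
    mean; expanding the squared deviations from it gives the Cauchy-Schwarz inequality.\<close>
  have "0 \<le> (\<Sum>j = a..<b. (d j - D / k)\<^sup>2)" by (intro sum_nonneg) simp
  also have "\<dots> = (\<Sum>j = a..<b. (d j)\<^sup>2 - 2 * (D / k) * d j + (D / k)\<^sup>2)"
    by (intro sum.cong) (auto simp: power2_diff)
  also have "\<dots> = (\<Sum>j = a..<b. (d j)\<^sup>2) - 2 * (D / k) * (\<Sum>j = a..<b. d j) + k * (D / k)\<^sup>2"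
    using assms by (simp add: sum.distrib sum_subtractf sum_distrib_left k_def of_nat_diff)
  also have "\<dots> = (\<Sum>j = a..<b. (d j)\<^sup>2) - D\<^sup>2 / k"
    unfolding D using k by (simp add: power2_eq_square field_simps)
  finally have "D\<^sup>2 \<le> k * (\<Sum>j = a..<b. (d j)\<^sup>2)" using k by (simp add: field_simps)
  then show ?thesis
    unfolding k_def D_def d_def using assms by (simp add: of_nat_diff power2_commute)
qed simp

lemma path_energy_point_bound:
  fixes f :: "nat \<Rightarrow> real"
  assumes i: "0 < i" "i < N"
  defines "Q \<equiv> (\<Sum>j<N. (f j - f (Suc j))\<^sup>2)"
  shows "(f i)\<^sup>2 \<le> 2 * ((f 0)\<^sup>2 + (f N)\<^sup>2) + real N / 2 * (Q - (f 0 - f N)\<^sup>2 / real N)"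
proof -
  define s t where "s = real i" and "t = real (N - i)"
  have st: "s > 0" "t > 0" and N: "real N = s + t" using i unfolding s_def t_def by auto
  \<comment> \<open>\<open>lin\<close> is the value at \<open>i\<close> of the linear function that
    agrees with \<open>f\<close> at 0 and \<open>N\<close>.\<close>
  define lin z where "lin = (t * f 0 + s * f N) / (s + t)" and "z = f i - lin"
  have "Q = (\<Sum>j = 0..<i. (f j - f (Suc j))\<^sup>2) + (\<Sum>j = i..<N. (f j - f (Suc j))\<^sup>2)"
    unfolding Q_def lessThan_atLeast0 using i by (subst sum.atLeastLessThan_concat) auto
  moreover have "(f i - f 0)\<^sup>2 / s \<le> (\<Sum>j = 0..<i. (f j - f (Suc j))\<^sup>2)"
    using path_energy_ge[of 0 i f] st unfolding s_def by (simp add: field_simps)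
  moreover have "(f N - f i)\<^sup>2 / t \<le> (\<Sum>j = i..<N. (f j - f (Suc j))\<^sup>2)"
    using path_energy_ge[of i N f] st i unfolding t_def by (simp add: field_simps)
  ultimately have Q: "(f i - f 0)\<^sup>2 / s + (f N - f i)\<^sup>2 / t \<le> Q" by linarith
  \<comment> \<open>An exact identity: bending the linear interpolation by \<open>z\<close> at the
    single point \<open>i\<close> costs precisely this much energy.\<close>
  have "(f i - f 0)\<^sup>2 / s + (f N - f i)\<^sup>2 / t - (f 0 - f N)\<^sup>2 / (s + t) = (s + t) / (s * t) * z\<^sup>2"
    unfolding z_def lin_def using st
    by (simp add: divide_simps power2_eq_square) (simp add: algebra_simps)
  then have "(s + t) / (s * t) * z\<^sup>2 \<le> Q - (f 0 - f N)\<^sup>2 / (s + t)" using Q by linarith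
  \<comment> \<open>The inequality of arithmetic and geometric means for \<open>s\<close> and
    \<open>t\<close>, that is, \<open>(s - t)\<^sup>2\<close> is nonnegative.\<close>
  moreover have "4 / (s + t) \<le> (s + t) / (s * t)"
    using st sum_squares_ge_zero[of "s - t" 0] by (simp add: field_simps power2_eq_square)
  then have "4 / (s + t) * z\<^sup>2 \<le> (s + t) / (s * t) * z\<^sup>2" by (rule mult_right_mono) simp
  ultimately have "4 / (s + t) * z\<^sup>2 \<le> Q - (f 0 - f N)\<^sup>2 / (s + t)" by linarith
  then have z: "2 * z\<^sup>2 \<le> real N / 2 * (Q - (f 0 - f N)\<^sup>2 / real N)" unfolding N
    using mult_left_mono[of "4 / (s + t) * z\<^sup>2" "Q - (f 0 - f N)\<^sup>2 / (s + t)" "(s + t) / 2"] st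
    by (simp add: field_simps)
  \<comment> \<open>Convexity of the square, with the slack written out as a sum of nonnegative
    terms.\<close>
  have "(f 0)\<^sup>2 + (f N)\<^sup>2 - lin\<^sup>2 =
      (s * (f 0)\<^sup>2 + t * (f N)\<^sup>2) / (s + t) + s * t * ((f 0 - f N) / (s + t))\<^sup>2"
    unfolding lin_def using st
    by (simp add: divide_simps power2_eq_square) (simp add: algebra_simps)
  also have "\<dots> \<ge> 0" using st by simp
  finally have lin: "lin\<^sup>2 \<le> (f 0)\<^sup>2 + (f N)\<^sup>2" by simp
  have "(f i)\<^sup>2 = 2 * lin\<^sup>2 + 2 * z\<^sup>2 - (lin - z)\<^sup>2"
    unfolding z_def by (simp add: power2_eq_square algebra_simps)
  also have "\<dots> \<le> 2 * lin\<^sup>2 + 2 * z\<^sup>2" by simp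
  also have "\<dots> \<le> 2 * ((f 0)\<^sup>2 + (f N)\<^sup>2) + real N / 2 * (Q - (f 0 - f N)\<^sup>2 / real N)"
    using lin by (intro add_mono z) simp
  finally show ?thesis .
qed


section \<open>Paths and arcs of the subdivided graph\<close>

lemma set_zip_consecutive:
  "set (zip (u # p) (p @ [v])) =
    (\<lambda>i. ((u # p @ [v]) ! i, (u # p @ [v]) ! Suc i)) ` {..<Suc (length p)}"
proof -
  have "(u # p) ! i = (u # p @ [v]) ! i" if "i < Suc (length p)" for i
    using that nth_append[of "u # p" "[v]" i] by simp
  then show ?thesis by (force simp: set_zip image_iff)
qed

text \<open>The third claim says that an arc of a properly subdivided edge touches a new vertex.
  Since new vertices belong to one edge only, such an arc reveals the edge it comes from.\<close>

lemma set_zip_consecutive_cases: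
  assumes "(s, t) \<in> set (zip (u # p) (p @ [v]))"
  shows "s = u \<or> s \<in> set p" "t = v \<or> t \<in> set p" "p = [] \<or> s \<in> set p \<or> t \<in> set p"
proof -
  show "s = u \<or> s \<in> set p" "t = v \<or> t \<in> set p"
    using set_zip_leftD[OF assms] set_zip_rightD[OF assms] by auto
  show "p = [] \<or> s \<in> set p \<or> t \<in> set p"
    using assms by (cases p) (auto dest: set_zip_leftD)
qed

locale subdivided_graph = pair_graph G for G :: "'a pair_pre_digraph" +
  fixes H :: "'a pair_pre_digraph" and m :: nat and P :: "'a \<times> 'a \<Rightarrow> 'a list"
  assumes P_length: "(u, v) \<in> parcs G \<Longrightarrow> length (P (u, v)) \<le> m"
    and P_distinct: "(u, v) \<in> parcs G \<Longrightarrow> distinct (P (u, v))"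
    and P_new: "(u, v) \<in> parcs G \<Longrightarrow> set (P (u, v)) \<inter> pverts G = {}"
    and P_swap: "(u, v) \<in> parcs G \<Longrightarrow> P (v, u) = rev (P (u, v))"
    and P_disjoint: "(u, v) \<in> parcs G \<Longrightarrow> (x, y) \<in> parcs G \<Longrightarrow> {u, v} \<noteq> {x, y} \<Longrightarrow>
      set (P (u, v)) \<inter> set (P (x, y)) = {}"
    and pverts_H: "pverts H = pverts G \<union> (\<Union>a \<in> parcs G. set (P a))"
    and parcs_H: "parcs H = (\<Union>(u, v) \<in> parcs G. set (zip (u # P (u, v)) (P (u, v) @ [v])))"
begin

definition path :: "'a \<times> 'a \<Rightarrow> 'a list" where
  "path a = fst a # P a @ [snd a]"

definition path_arcs :: "'a \<times> 'a \<Rightarrow> ('a \<times> 'a) set" where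
  "path_arcs a = set (zip (fst a # P a) (P a @ [snd a]))"

text \<open>Counts the edges of the path, not its new vertices.\<close>

definition len :: "'a \<times> 'a \<Rightarrow> nat" where
  "len a = Suc (length (P a))"

definition path_energy :: "('a \<Rightarrow> real) \<Rightarrow> 'a \<times> 'a \<Rightarrow> real" where
  "path_energy x a = (\<Sum>i<len a. (x (path a ! i) - x (path a ! Suc i))\<^sup>2)"

lemma parcs_H_eq: "parcs H = (\<Union>a \<in> parcs G. path_arcs a)"
  unfolding parcs_H path_arcs_def by (auto simp: case_prod_unfold)

lemma path_arcs_eq: "path_arcs a = (\<lambda>i. (path a ! i, path a ! Suc i)) ` {..<len a}"
  unfolding path_arcs_def path_def len_def by (rule set_zip_consecutive)

lemma length_path: "length (path a) = Suc (len a)"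
  unfolding path_def len_def by simp

lemma path_first: "path a ! 0 = fst a" and path_last: "path a ! len a = snd a"
  unfolding path_def len_def by (auto simp: nth_append)

lemma distinct_path:
  assumes "a \<in> parcs G"
  shows "distinct (path a)"
proof -
  obtain u v where a: "a = (u, v)" by (cases a)
  have "u \<noteq> v" "u \<in> pverts G" "v \<in> pverts G"
    using assms pair_no_loops[OF assms] in_arcsD1 in_arcsD2 unfolding a by auto
  then show ?thesis using assms P_distinct[of u v] P_new[of u v] unfolding path_def a by auto
qed

lemma path_swap:
  assumes "(u, v) \<in> parcs G"
  shows "path (v, u) = rev (path (u, v))"
  using P_swap[OF assms] unfolding path_def by simp

lemma len_swap:
  assumes "(u, v) \<in> parcs G"
  shows "len (v, u) = len (u, v)"
  using P_swap[OF assms] unfolding len_def by simp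

lemma path_swap_nth:
  assumes "(u, v) \<in> parcs G" "i \<le> len (u, v)"
  shows "path (v, u) ! i = path (u, v) ! (len (u, v) - i)"
  using assms length_path[of "(u, v)"] unfolding path_swap[OF assms(1)]
  by (simp add: rev_nth)

text \<open>Opposite arcs of one edge give the same path traversed in opposite directions, and
  different edges share no new vertex. This is what lets the energy of \<open>H\<close> split over
  the arcs of \<open>G\<close>.\<close>

lemma path_arcs_disjoint:
  assumes a: "a \<in> parcs G" and b: "b \<in> parcs G" and ab: "a \<noteq> b"
  shows "path_arcs a \<inter> path_arcs b = {}"
proof (rule ccontr)
  assume "path_arcs a \<inter> path_arcs b \<noteq> {}"
  then obtain s t where sta: "(s, t) \<in> path_arcs a" and stb: "(s, t) \<in> path_arcs b" by fast
  obtain u v where uv: "a = (u, v)" by (cases a)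
  obtain x y where xy: "b = (x, y)" by (cases b)
  note arcs = a[unfolded uv] b[unfolded xy]
  note verts = in_arcsD1[OF arcs(1)] in_arcsD2[OF arcs(1)] in_arcsD1[OF arcs(2)] in_arcsD2[OF arcs(2)]
  show False
  proof (cases "{u, v} = {x, y}")
    case True
    then have b_swap: "b = (v, u)" using ab unfolding uv xy by (auto simp: doubleton_eq_iff)
    obtain i where i: "i < len a" "s = path a ! i" "t = path a ! Suc i"
      using sta unfolding path_arcs_eq by auto
    obtain j where j: "j < len b" "s = path b ! j" "t = path b ! Suc j"
      using stb unfolding path_arcs_eq by auto
    have lb: "len b = len a" using len_swap[OF arcs(1)] b_swap uv by simp
    have "s = path a ! (len a - j)" "t = path a ! (len a - Suc j)"
      using path_swap_nth[OF arcs(1), of j] path_swap_nth[OF arcs(1), of "Suc j"] j lb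
      unfolding b_swap uv by auto
    \<comment> \<open>On a path without repetitions positions are determined by vertices; one
      traversal increases the position and the other decreases it, so the two equations contradict
      each other.\<close>
    then have "i = len a - j" "Suc i = len a - Suc j"
      using i distinct_path[OF a] length_path[of a] j(1) lb
      by (auto simp: nth_eq_iff_index_eq)
    then show False by simp
  next
    case False
    note D = P_disjoint[OF arcs False] P_new[OF arcs(1)] P_new[OF arcs(2)]
    note A = set_zip_consecutive_cases[of s t u "P (u, v)" v]
    note B = set_zip_consecutive_cases[of s t x "P (x, y)" y]
    have za: "(s, t) \<in> set (zip (u # P (u, v)) (P (u, v) @ [v]))"
      and zb: "(s, t) \<in> set (zip (x # P (x, y)) (P (x, y) @ [y]))"
      using sta stb unfolding path_arcs_def uv xy by auto
    show False
    proof (cases "P (u, v) = []")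
      case True
      then have "s = u" "t = v" using za by auto
      \<comment> \<open>Both ends of the arc are old vertices, so the other edge is not subdivided
        either and the arc is that edge itself.\<close>
      moreover have "P (x, y) = []" using B(3)[OF zb] D(3) verts \<open>s = u\<close> \<open>t = v\<close> by blast
      ultimately show False using zb False by auto
    next
      case nonempty: False
      then consider "s \<in> set (P (u, v))" | "t \<in> set (P (u, v))" using A(3)[OF za] by blast
      then show False
      proof cases
        case 1 then show False using B(1)[OF zb] D verts by blast
      next
        case 2 then show False using B(2)[OF zb] D verts by blast
      qed
    qed
  qed
qed

text \<open>Each arc of \<open>H\<close> lies in \<open>path_arcs a\<close> for exactly one arc
  \<open>a\<close> of \<open>G\<close>. Both sides thus count every edge of \<open>H\<close> in both
  directions.\<close>

lemma dirichlet_energy_H: "dirichlet_energy H x = (\<Sum>a \<in> parcs G. path_energy x a)"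
proof -
  have "dirichlet_energy H x = (\<Sum>a \<in> parcs G. \<Sum>(s, t) \<in> path_arcs a. (x s - x t)\<^sup>2)"
    unfolding dirichlet_energy_def parcs_H_eq
    by (rule sum.UNION_disjoint)
      (use pair_finite_arcs path_arcs_disjoint in \<open>auto simp: path_arcs_def\<close>)
  also have "\<dots> = (\<Sum>a \<in> parcs G. path_energy x a)"
  proof (rule sum.cong)
    fix a assume a: "a \<in> parcs G"
    have "inj_on (\<lambda>i. (path a ! i, path a ! Suc i)) {..<len a}"
      using distinct_path[OF a] length_path[of a] by (auto simp: inj_on_def nth_eq_iff_index_eq)
    then show "(\<Sum>(s, t) \<in> path_arcs a. (x s - x t)\<^sup>2) = path_energy x a"
      unfolding path_arcs_eq path_energy_def by (simp add: sum.reindex)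
  qed simp
  finally show ?thesis .
qed

lemma pair_graph_H: "pair_graph H"
proof
  fix e assume e: "e \<in> parcs H"
  obtain s t where st: "e = (s, t)" by (cases e)
  from e obtain u v where uv: "(u, v) \<in> parcs G" and z: "(s, t) \<in> path_arcs (u, v)"
    unfolding parcs_H_eq st by auto
  note cases = set_zip_consecutive_cases[OF z[unfolded path_arcs_def fst_conv snd_conv]]
  show "fst e \<in> pverts H" "snd e \<in> pverts H"
    using cases(1,2) uv in_arcsD1[OF uv] in_arcsD2[OF uv] unfolding pverts_H st by auto
  obtain i where "i < len (u, v)" "s = path (u, v) ! i" "t = path (u, v) ! Suc i"
    using z unfolding path_arcs_eq by auto
  then show "fst e \<noteq> snd e"
    using distinct_path[OF uv] length_path[of "(u, v)"] unfolding st by (simp add: nth_eq_iff_index_eq)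
next
  show "finite (pverts H)" "finite (parcs H)"
    unfolding pverts_H parcs_H_eq path_arcs_def using pair_finite_verts pair_finite_arcs by auto
next
  have "(t, s) \<in> parcs H" if "(s, t) \<in> parcs H" for s t
  proof -
    from that obtain u v where uv: "(u, v) \<in> parcs G" and z: "(s, t) \<in> path_arcs (u, v)"
      unfolding parcs_H_eq by auto
    obtain i where i: "i < len (u, v)" "s = path (u, v) ! i" "t = path (u, v) ! Suc i"
      using z unfolding path_arcs_eq by auto
    \<comment> \<open>The arc from position \<open>i\<close> to \<open>Suc i\<close>, reversed,
      starts at this position of the opposite path.\<close>
    let ?j = "len (u, v) - Suc i"
    have "t = path (v, u) ! ?j" "s = path (v, u) ! Suc ?j"
      using path_swap_nth[OF uv, of ?j] path_swap_nth[OF uv, of "Suc ?j"] i by auto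
    moreover have "?j < len (v, u)" using i len_swap[OF uv] by simp
    ultimately have "(t, s) \<in> path_arcs (v, u)" unfolding path_arcs_eq by blast
    then show ?thesis using parcs_swap[OF uv] unfolding parcs_H_eq by blast
  qed
  then show "symmetric (with_proj H)" unfolding symmetric_def sym_def by simp
qed

section \<open>The Poincare inequality on the subdivided graph\<close>

lemma sum_internal_vertices_le:
  fixes f :: "'a \<Rightarrow> real"
  assumes f: "\<And>w. f w \<ge> 0"
  shows "2 * (\<Sum>w \<in> (\<Union>a \<in> parcs G. set (P a)). f w) \<le> (\<Sum>a \<in> parcs G. \<Sum>w \<in> set (P a). f w)"
proof -
  let ?I = "\<Union>a \<in> parcs G. set (P a)"
  have fin: "finite ?I" using pair_finite_arcs by auto
  have "(\<Sum>a \<in> parcs G. \<Sum>w \<in> set (P a). f w)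
      = (\<Sum>a \<in> parcs G. \<Sum>w \<in> ?I. if w \<in> set (P a) then f w else 0)"
    by (intro sum.cong refl sum.mono_neutral_cong_left fin) auto
  also have "\<dots> = (\<Sum>w \<in> ?I. \<Sum>a \<in> parcs G. if w \<in> set (P a) then f w else 0)"
    by (rule sum.swap)
  also have "\<dots> \<ge> (\<Sum>w \<in> ?I. 2 * f w)"
  proof (rule sum_mono)
    fix w assume "w \<in> ?I"
    then obtain u v where uv: "(u, v) \<in> parcs G" and w: "w \<in> set (P (u, v))" by auto
    have "u \<noteq> v" using pair_no_loops[OF uv] by simp
    \<comment> \<open>A new vertex lies on the paths of both arcs of its edge, whence the factor 2;
      as \<open>f\<close> is nonnegative, dropping all other arcs only lowers the sum.\<close>
    then have "2 * f w = (\<Sum>a \<in> {(u, v), (v, u)}. if w \<in> set (P a) then f w else 0)"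
      using w P_swap[OF uv] by simp
    also have "\<dots> \<le> (\<Sum>a \<in> parcs G. if w \<in> set (P a) then f w else 0)"
      using pair_finite_arcs uv parcs_swap[OF uv] f by (intro sum_mono2) auto
    finally show "2 * f w \<le> (\<Sum>a \<in> parcs G. if w \<in> set (P a) then f w else 0)" .
  qed
  finally show ?thesis by (simp add: sum_distrib_left)
qed

text \<open>The part of the energy of a path that remains after subtracting the linear interpolation
  between its ends.\<close>

definition excess :: "('a \<Rightarrow> real) \<Rightarrow> 'a \<times> 'a \<Rightarrow> real" where
  "excess x a = path_energy x a - (x (fst a) - x (snd a))\<^sup>2 / real (len a)"

lemma excess_nonneg: "excess x a \<ge> 0"
proof -
  have "len a > 0" unfolding len_def by simp
  then show ?thesis
    using path_energy_ge[of 0 "len a" "\<lambda>i. x (path a ! i)"]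
    unfolding excess_def path_energy_def path_first path_last
    by (simp add: field_simps atLeast0LessThan power2_commute)
qed

text \<open>The pointwise bound is summed over at most \<open>m\<close> inner vertices of a path
  with at most \<open>m + 1\<close> edges.\<close>

lemma sum_path_le:
  assumes a: "a \<in> parcs G"
  shows "(\<Sum>w \<in> set (P a). (x w)\<^sup>2) \<le>
    real m * (2 * ((x (fst a))\<^sup>2 + (x (snd a))\<^sup>2) + (real m + 1) / 2 * excess x a)"
    (is "_ \<le> _ * ?B")
proof -
  have len: "real (len a) \<le> real m + 1" and card: "card (set (P a)) \<le> m"
    using P_length[of "fst a" "snd a"] a card_length[of "P a"] unfolding len_def by auto
  have B0: "?B \<ge> 0" using excess_nonneg[of x a] by simp
  have "(x w)\<^sup>2 \<le> ?B" if w: "w \<in> set (P a)" for w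
  proof -
    obtain j where j: "j < length (P a)" "w = P a ! j" using w by (metis in_set_conv_nth)
    \<comment> \<open>The shift by one accounts for the old vertex at the start of
      \<open>path a\<close>.\<close>
    have "path a ! Suc j = w" using j unfolding path_def by (simp add: nth_append)
    moreover have "Suc j < len a" using j(1) unfolding len_def by simp
    ultimately have "(x w)\<^sup>2 \<le> 2 * ((x (fst a))\<^sup>2 + (x (snd a))\<^sup>2) + real (len a) / 2 * excess x a"
      using path_energy_point_bound[of "Suc j" "len a" "\<lambda>i. x (path a ! i)"]
      unfolding excess_def path_energy_def path_first path_last by simp
    also have "real (len a) / 2 * excess x a \<le> (real m + 1) / 2 * excess x a"
      using len excess_nonneg[of x a] by (intro mult_right_mono) auto
    finally show ?thesis by simp
  qed
  then have "(\<Sum>w \<in> set (P a). (x w)\<^sup>2) \<le> real (card (set (P a))) * ?B"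
    by (intro sum_bounded_above)
  also have "\<dots> \<le> real m * ?B" using card B0 by (intro mult_right_mono) auto
  finally show ?thesis .
qed

text \<open>Summing the bound for single paths over all arcs charges each old vertex once for every
  arc leaving it and once for every arc entering it. The sum over arcs meets each new vertex twice,
  so the resulting constants are halved.\<close>

lemma sum_squares_H_le:
  assumes deg: "\<And>v. v \<in> pverts G \<Longrightarrow> real (out_degree (with_proj G) v) \<le> \<Delta>"
  shows "(\<Sum>w \<in> pverts H. (x w)\<^sup>2) \<le> (1 + 2 * real m * \<Delta>) * (\<Sum>v \<in> pverts G. (x v)\<^sup>2)
    + real m * (real m + 1) / 4 * (\<Sum>a \<in> parcs G. excess x a)"
proof -
  let ?I = "\<Union>a \<in> parcs G. set (P a)"
  let ?S = "\<Sum>v \<in> pverts G. (x v)\<^sup>2"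
  have "(\<Sum>(u, v) \<in> parcs G. (x u)\<^sup>2) = (\<Sum>u \<in> pverts G. real (out_degree (with_proj G) u) * (x u)\<^sup>2)"
    by (rule sum_parcs_fst)
  also have "\<dots> \<le> (\<Sum>u \<in> pverts G. \<Delta> * (x u)\<^sup>2)"
    using deg by (intro sum_mono mult_right_mono) auto
  finally have fst: "(\<Sum>(u, v) \<in> parcs G. (x u)\<^sup>2) \<le> \<Delta> * ?S" by (simp add: sum_distrib_left)
  have "(\<Sum>a \<in> parcs G. (x (fst a))\<^sup>2 + (x (snd a))\<^sup>2)
      = (\<Sum>(u, v) \<in> parcs G. (x u)\<^sup>2) + (\<Sum>(u, v) \<in> parcs G. (x v)\<^sup>2)"
    by (simp add: sum.distrib case_prod_unfold)
  also have "(\<Sum>(u, v) \<in> parcs G. (x v)\<^sup>2) = (\<Sum>(u, v) \<in> parcs G. (x u)\<^sup>2)"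
    by (rule sum_parcs_swap)
  finally have ends: "(\<Sum>a \<in> parcs G. (x (fst a))\<^sup>2 + (x (snd a))\<^sup>2) \<le> 2 * \<Delta> * ?S"
    using fst by simp
  have "2 * (\<Sum>w \<in> ?I. (x w)\<^sup>2) \<le> (\<Sum>a \<in> parcs G. \<Sum>w \<in> set (P a). (x w)\<^sup>2)"
    by (rule sum_internal_vertices_le) simp
  also have "\<dots> \<le> (\<Sum>a \<in> parcs G. real m *
      (2 * ((x (fst a))\<^sup>2 + (x (snd a))\<^sup>2) + (real m + 1) / 2 * excess x a))"
    by (intro sum_mono sum_path_le)
  also have "\<dots> = 2 * real m * (\<Sum>a \<in> parcs G. (x (fst a))\<^sup>2 + (x (snd a))\<^sup>2)
      + real m * (real m + 1) / 2 * (\<Sum>a \<in> parcs G. excess x a)"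
    unfolding sum_distrib_left sum.distrib[symmetric]
    by (intro sum.cong) (auto simp: algebra_simps)
  also have "2 * real m * (\<Sum>a \<in> parcs G. (x (fst a))\<^sup>2 + (x (snd a))\<^sup>2) \<le> 2 * real m * (2 * \<Delta> * ?S)"
    using ends by (intro mult_left_mono) auto
  finally have "(\<Sum>w \<in> ?I. (x w)\<^sup>2) \<le> 2 * real m * \<Delta> * ?S
      + real m * (real m + 1) / 4 * (\<Sum>a \<in> parcs G. excess x a)" by simp
  moreover have "(\<Sum>w \<in> pverts H. (x w)\<^sup>2) = ?S + (\<Sum>w \<in> ?I. (x w)\<^sup>2)"
    unfolding pverts_H using pair_finite_verts pair_finite_arcs P_new
    by (intro sum.union_disjoint) fastforce+
  ultimately show ?thesis by (simp add: algebra_simps)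
qed

text \<open>The energy splits into the part \<open>T\<close> of the linear interpolations and the
  total excess \<open>Z\<close>. The two arms of the minimum serve the two parts: the first lets
  \<open>T\<close> pay for the old vertices' share of the squares, the second lets \<open>Z\<close>
  pay for the rest.\<close>

lemma Poincare_inequality_H:
  assumes deg: "\<And>v. v \<in> pverts G \<Longrightarrow> real (out_degree (with_proj G) v) \<le> \<Delta>" and \<Delta>: "\<Delta> \<ge> 1"
    and card: "card (pverts G) \<ge> 2" and x: "(\<Sum>v \<in> pverts G. x v) = 0"
  shows "min (1 / \<Delta> * algebraic_connectivity G) 4 / (2 * (real m + 1)\<^sup>2) * (\<Sum>w \<in> pverts H. (x w)\<^sup>2)
    \<le> dirichlet_energy H x / 2"
proof -
  define a where "a = algebraic_connectivity G"
  define M where "M = real m + 1"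
  define r where "r = min (1 / \<Delta> * a) 4 / (2 * M\<^sup>2)"
  define S where "S = (\<Sum>v \<in> pverts G. (x v)\<^sup>2)"
  define Z where "Z = (\<Sum>e \<in> parcs G. excess x e)"
  define T where "T = (\<Sum>e \<in> parcs G. (x (fst e) - x (snd e))\<^sup>2 / real (len e))"
  have M: "M \<ge> 1" "real m = M - 1" unfolding M_def by auto
  have a0: "a \<ge> 0" unfolding a_def by (rule algebraic_connectivity_nonneg[OF card])
  have S0: "S \<ge> 0" unfolding S_def by (simp add: sum_nonneg)
  have Z0: "Z \<ge> 0" unfolding Z_def by (intro sum_nonneg excess_nonneg)
  have r0: "r \<ge> 0" unfolding r_def using a0 \<Delta> by simp
  have energy: "dirichlet_energy H x = T + Z"
    unfolding dirichlet_energy_H T_def Z_def excess_def by (simp add: sum_subtractf)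
  \<comment> \<open>Every path has at most \<open>M\<close> edges, so replacing an edge of
    \<open>G\<close> by its path lowers the energy of the linear part by a factor of at most
    \<open>M\<close>.\<close>
  have "dirichlet_energy G x \<le> M * T"
    unfolding dirichlet_energy_def T_def sum_distrib_left case_prod_unfold
  proof (rule sum_mono)
    fix e assume "e \<in> parcs G"
    then have "real (len e) \<le> M" "real (len e) > 0"
      using P_length[of "fst e" "snd e"] unfolding len_def M_def by auto
    then show "(x (fst e) - x (snd e))\<^sup>2 \<le> M * ((x (fst e) - x (snd e))\<^sup>2 / real (len e))"
      using mult_right_mono[of "real (len e)" M "(x (fst e) - x (snd e))\<^sup>2"]
      by (simp add: field_simps)
  qed
  then have aS: "a * S \<le> M * T / 2"
    using algebraic_connectivity_Rayleigh[OF card x] unfolding a_def S_def by simp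
  \<comment> \<open>The term 1 for the old vertices themselves is absorbed by raising
    \<open>m\<close> to \<open>M\<close>, since \<open>2 * \<Delta>\<close> is at least 1.\<close>
  have "1 + 2 * real m * \<Delta> \<le> 2 * M * \<Delta>" unfolding M(2) using \<Delta> by (simp add: algebra_simps)
  then have "r * ((1 + 2 * real m * \<Delta>) * S) \<le> r * (2 * M * \<Delta> * S)"
    using r0 S0 by (intro mult_left_mono mult_right_mono)
  \<comment> \<open>The first arm of the minimum: \<open>\<Delta>\<close> cancels and one factor
    \<open>M\<close> remains, which the bound on \<open>a * S\<close> uses up.\<close>
  also have "\<dots> \<le> (1 / \<Delta> * a / (2 * M\<^sup>2)) * (2 * M * \<Delta> * S)"
    unfolding r_def using M \<Delta> S0 by (intro mult_right_mono divide_right_mono) auto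
  also have "\<dots> = a * S / M" using M \<Delta> by (simp add: power2_eq_square)
  also have "\<dots> \<le> T / 2" using aS M by (simp add: field_simps)
  finally have 1: "r * ((1 + 2 * real m * \<Delta>) * S) \<le> T / 2" .
  \<comment> \<open>The second arm of the minimum: with 4 in the numerator the constants leave
    \<open>real m / M\<close>, which is at most 1.\<close>
  have "r * (real m * (real m + 1) / 4 * Z) \<le> (4 / (2 * M\<^sup>2)) * (real m * (real m + 1) / 4 * Z)"
    unfolding r_def using M Z0 by (intro mult_right_mono divide_right_mono) auto
  also have "\<dots> = (real m / M) * (Z / 2)"
    using M by (simp add: power2_eq_square M_def[symmetric] mult.commute)
  also have "\<dots> \<le> 1 * (Z / 2)" using M Z0 by (intro mult_right_mono) auto
  finally have 2: "r * (real m * (real m + 1) / 4 * Z) \<le> Z / 2" by simp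
  have "r * (\<Sum>w \<in> pverts H. (x w)\<^sup>2)
      \<le> r * ((1 + 2 * real m * \<Delta>) * S + real m * (real m + 1) / 4 * Z)"
    unfolding S_def Z_def by (intro mult_left_mono sum_squares_H_le deg r0)
  also have "\<dots> \<le> T / 2 + Z / 2"
    using add_mono[OF 1 2] by (subst distrib_left[of r])
  finally show ?thesis unfolding energy r_def M_def a_def by (simp add: add_divide_distrib)
qed

text \<open>The variational bound for \<open>H\<close> is about functions with sum zero over all
  vertices, the Poincare inequality about sum zero over the old ones. Subtracting the mean over the
  old vertices mediates: differences along arcs are unchanged, and the sum of squares cannot
  drop.\<close>

lemma algebraic_connectivity_H_ge:
  assumes deg: "\<And>v. v \<in> pverts G \<Longrightarrow> real (out_degree (with_proj G) v) \<le> \<Delta>" and \<Delta>: "\<Delta> \<ge> 1"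
    and card: "card (pverts G) \<ge> 2"
  shows "min (1 / \<Delta> * algebraic_connectivity G) 4 / (2 * (real m + 1)\<^sup>2) \<le> algebraic_connectivity H"
    (is "?r \<le> _")
proof -
  interpret H: pair_graph H by (rule pair_graph_H)
  have "card (pverts G) \<le> card (pverts H)"
    using H.pair_finite_verts by (intro card_mono) (auto simp: pverts_H)
  then have "card (pverts H) \<ge> 2" using card by simp
  then show ?thesis
  proof (rule H.algebraic_connectivity_lower_bound)
    fix y :: "'a \<Rightarrow> real" assume y: "(\<Sum>v \<in> pverts H. y v) = 0"
    define c where "c = (\<Sum>v \<in> pverts G. y v) / card (pverts G)"
    have c: "(\<Sum>v \<in> pverts G. y v - c) = 0"
      using card unfolding c_def by (simp add: sum_subtractf)
    \<comment> \<open>The cross term vanishes because \<open>y\<close> has sum zero over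
      \<open>H\<close>, so the shift only adds a nonnegative constant.\<close>
    have "(\<Sum>w \<in> pverts H. (y w - c)\<^sup>2)
        = (\<Sum>w \<in> pverts H. (y w)\<^sup>2 - 2 * c * y w + c\<^sup>2)"
      by (intro sum.cong) (auto simp: power2_diff)
    also have "\<dots> = (\<Sum>w \<in> pverts H. (y w)\<^sup>2) - 2 * c * (\<Sum>w \<in> pverts H. y w)
        + card (pverts H) * c\<^sup>2"
      by (simp add: sum.distrib sum_subtractf sum_distrib_left)
    finally have "(\<Sum>w \<in> pverts H. (y w)\<^sup>2) \<le> (\<Sum>w \<in> pverts H. (y w - c)\<^sup>2)"
      unfolding y by simp
    moreover have "?r \<ge> 0" using algebraic_connectivity_nonneg[OF card] \<Delta> by simp
    ultimately have "?r * (\<Sum>w \<in> pverts H. (y w)\<^sup>2) \<le> ?r * (\<Sum>w \<in> pverts H. (y w - c)\<^sup>2)"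
      by (intro mult_left_mono)
    also have "\<dots> \<le> dirichlet_energy H (\<lambda>v. y v - c) / 2"
      by (rule Poincare_inequality_H[OF deg \<Delta> card c])
    also have "dirichlet_energy H (\<lambda>v. y v - c) = dirichlet_energy H y"
      unfolding dirichlet_energy_def by simp
    finally show "?r * (\<Sum>w \<in> pverts H. (y w)\<^sup>2) \<le> dirichlet_energy H y / 2" .
  qed
qed

end

section \<open>From the definition of subdivision to the theorem\<close>

lemma edge_subdivision_imp_subdivided_graph:
  assumes "pair_graph G" and "edge_subdivision m G H"
  shows "\<exists>P. subdivided_graph G H m P"
proof -
  from assms(2) obtain P where P:
    "(\<forall>(u, v) \<in> parcs G. length (P (u, v)) \<le> m \<and> distinct (P (u, v)) \<and>
        set (P (u, v)) \<inter> pverts G = {} \<and> P (v, u) = rev (P (u, v))) \<and>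
     (\<forall>(u, v) \<in> parcs G. \<forall>(x, y) \<in> parcs G.
        {u, v} \<noteq> {x, y} \<longrightarrow> set (P (u, v)) \<inter> set (P (x, y)) = {}) \<and>
     pverts H = pverts G \<union> (\<Union>a \<in> parcs G. set (P a)) \<and>
     parcs H = (\<Union>(u, v) \<in> parcs G. set (zip (u # P (u, v)) (P (u, v) @ [v])))"
    unfolding edge_subdivision_def by (rule exE)
  have "subdivided_graph G H m P"
  proof (intro subdivided_graph.intro subdivided_graph_axioms.intro assms(1))
    fix u v assume uv: "(u, v) \<in> parcs G"
    show "length (P (u, v)) \<le> m" "distinct (P (u, v))"
      "set (P (u, v)) \<inter> pverts G = {}" "P (v, u) = rev (P (u, v))"
      using bspec[OF conjunct1[OF P] uv] by simp_all
    fix x y assume xy: "(x, y) \<in> parcs G" and "{u, v} \<noteq> {x, y}"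
    then show "set (P (u, v)) \<inter> set (P (x, y)) = {}"
      using bspec[OF conjunct1[OF conjunct2[OF P]] uv, simplified, THEN bspec[OF _ xy]] by simp
  next
    show "pverts H = pverts G \<union> (\<Union>a \<in> parcs G. set (P a))"
      "parcs H = (\<Union>(u, v) \<in> parcs G. set (zip (u # P (u, v)) (P (u, v) @ [v])))"
      using P by simp_all
  qed
  then show ?thesis by blast
qed

theorem theorem4p1:
  fixes G G' :: "'a pair_pre_digraph" and m :: nat
  assumes "pair_graph G"
    and "Digraph_Component.connected (with_proj G)"
    and "min_degree G \<ge> 2"
    and "edge_subdivision m G G'"
  shows "algebraic_connectivity G'
    \<ge> min (1 / real (max_degree G) * algebraic_connectivity G) 4 / (2 * (real m + 1)\<^sup>2)"
proof -
  interpret pair_graph G by fact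
  obtain P where "subdivided_graph G G' m P"
    using edge_subdivision_imp_subdivided_graph[OF assms(1,4)] by blast
  then interpret subdivided_graph G G' m P .
  let ?deg = "out_degree (with_proj G)"
  \<comment> \<open>Connectedness supplies a vertex. Its at least two out-neighbours show that
    \<open>G\<close> has at least two vertices, so that index 1 of the spectrum exists, and that the
    maximum degree is positive.\<close>
  have "pverts G \<noteq> {}"
    using assms(2) unfolding Digraph_Component.connected_def strongly_connected_def by simp
  then obtain v where v: "v \<in> pverts G" by blast
  have max: "?deg w \<le> max_degree G" if "w \<in> pverts G" for w
    unfolding max_degree_def using that pair_finite_verts by (intro Max_ge) auto
  have "2 \<le> ?deg v"
    using assms(3) v pair_finite_verts unfolding min_degree_def
    by (meson Min_le finite_imageI image_eqI le_trans)
  then have "max_degree G \<ge> 1" and "card (parcs G `` {v}) \<ge> 2"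
    using max[OF v] out_degree_eq_card_Image[of v] by linarith+
  moreover have "card (parcs G `` {v}) \<le> card (pverts G)"
    using pair_finite_verts in_arcsD2 by (intro card_mono) auto
  ultimately show ?thesis
    using max by (intro algebraic_connectivity_H_ge) auto
qed

end
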